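(* Let $\lambda\in\mathbb{C}$, and let $\mathcal{H}_0$ (basis $e_1,e_2,e_3$, only nonzero product of basis vectors $e_1\cdot e_3=e_2$) be equipped with the dendriform structure $e_1\prec e_3=(1-\lambda)e_2$, $e_1\succ e_3=\lambda e_2$ (all other $\prec$- and $\succ$-products of basis vectors zero). Let $a_{11},a_{12},a_{22},a_{23},a_{33}\in\mathbb{C}$. Each of the following elements $r\in\mathcal{H}_0\otimes\mathcal{H}_0$ is a symmetric solution of the $D$-equation in $\mathcal{H}_0$, and the corresponding product $\ast$ on $\mathcal{H}_0\oplus\mathcal{H}_0^*$ (products of basis vectors not listed are zero) gives a double construction of the Connes cocycle associated with $\mathcal{H}_0$ and its dual space $\mathcal{H}_0^*$. (1) $r=a_{11}e_1\otimes e_1+a_{12}(e_1\otimes e_2+e_2\otimes e_1)+a_{22}e_2\otimes e_2$, with $$e_1\ast e_3=e_2,\quad e_2^*\ast e_2^*=-a_{12}\lambda e_3^*,\quad e_2^*\ast e_1=\lambda e_3^*,\quad e_2^*\ast e_3=-a_{12}e_2,$$ $$e_2^*\ast e_1^*=-a_{11}\lambda e_3^*,\quad e_1^*\ast e_3=-a_{11}e_2,\quad e_3\ast e_2^*=a_{11}(1-\lambda)e_1+(1-\lambda)e_1^*+(1-\lambda)a_{12}e_2 .$$ (2) $r=a_{22}e_2\otimes e_2+a_{23}(e_2\otimes e_3+e_3\otimes e_2)+a_{33}e_3\otimes e_3$, with $$e_1\ast e_3=e_2,\quad e_2^*\ast e_2^*=(\lambda-1)a_{23}e_1^*,\quad e_1\ast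 e_2^*=-a_{23}e_2,\quad e_3\ast e_2^*=(1-\lambda)e_1^*,$$ $$e_3^*\ast e_2^*=(\lambda-1)a_{33}e_1^*,\quad e_1\ast e_3^*=-a_{33}e_2,\quad e_2^*\ast e_1=\lambda(a_{23}e_2+a_{33}e_3+e_3^* ) .$$ (3) $r=a_{12}(e_1\otimes e_2+e_2\otimes e_1)+a_{22}e_2\otimes e_2+a_{23}(e_2\otimes e_3+e_3\otimes e_2)$, with $$e_1\ast e_3=e_2,\quad e_2^*\ast e_2^*=a_{23}(\lambda-1)e_1^*,\quad e_2^*\ast e_3=a_{12}(\lambda-1)e_2,\quad e_1\ast e_2^*=-a_{23}e_2,$$ $$e_3\ast e_2^*=(1-\lambda)(a_{12}e_2+e_1^* ),\quad e_2^*\ast e_1=\lambda(a_{23}e_2+e_3^* ) .$$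
   Context: All algebras are over $\mathbb{C}$; $e_1^*,e_2^*,e_3^*$ is the dual basis of $\mathcal{H}_0^*$. For a dendriform algebra $(\mathcal{A},\prec,\succ)$ with $x\ast y=x\prec y+x\succ y$, the $D$-equation for $r=\sum_i x_i\otimes y_i\in\mathcal{A}\otimes\mathcal{A}$ is $r_{12}\ast r_{13}=r_{13}\prec r_{23}+r_{23}\succ r_{12}$, where $r_{12}\ast r_{13}=\sum_{i,j}x_i\ast x_j\otimes y_i\otimes y_j$, $r_{13}\prec r_{23}=\sum_{i,j}x_i\otimes x_j\otimes y_i\prec y_j$, $r_{23}\succ r_{12}=\sum_{i,j}x_j\otimes x_i\succ y_j\otimes y_i$. The element $r$ is symmetric if it is invariant under $x\otimes y\mapsto y\otimes x$. A double construction of the Connes cocycle associated with $\mathcal{A}_1$ and its dual space $\mathcal{A}_1^*$ is an associative algebra structure $\ast$ on the vector space $\mathcal{A}_1\oplus\mathcal{A}_1^*$ such that $\mathcal{A}_1$ (with its given product) and $\mathcal{A}_1^*$ are associative subalgebras and the natural antisymmetric form $\omega(x+a^*,y+b^* )=-\langle x,b^*\rangle+\langle a^*,y\rangle$ is a Connes cocycle, i.e. $\omega(u\ast v,w)+\omega(v\ast w,u)+\omega(w\ast u,v)=0$ for all $u,v,w$. *)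

theory Defs
  imports "HOL-Analysis.Analysis"
begin

definition bilinear_over ::
  "(complex \<Rightarrow> 'a \<Rightarrow> 'a) \<Rightarrow> (complex \<Rightarrow> 'b \<Rightarrow> 'b) \<Rightarrow> (complex \<Rightarrow> 'c \<Rightarrow> 'c) \<Rightarrow>
    ('a::ab_group_add \<Rightarrow> 'b::ab_group_add \<Rightarrow> 'c::ab_group_add) \<Rightarrow> bool" where
  "bilinear_over s1 s2 s3 f \<longleftrightarrow>
     (\<forall>x. Vector_Spaces.linear s2 s3 (f x)) \<and> (\<forall>y. Vector_Spaces.linear s1 s3 (\<lambda>x. f x y))"

lemma bilinear_over_simps:
  assumes "bilinear_over (*s) (*s) (*s) (f :: complex^'m \<Rightarrow> complex^'n \<Rightarrow> complex^'k)"
  shows "f (x + x') y = f x y + f x' y" "f x (y + y') = f x y + f x y'"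
    "f (c *s x) y = c *s f x y" "f x (c *s y) = c *s f x y"
proof -
  have l: "Vector_Spaces.linear (*s) (*s) (f x)"
    and r: "Vector_Spaces.linear (*s) (*s) (\<lambda>x. f x y)" for x y
    using assms by (auto simp: bilinear_over_def)
  show "f (x + x') y = f x y + f x' y" "f x (y + y') = f x y + f x y'"
    "f (c *s x) y = c *s f x y" "f x (c *s y) = c *s f x y"
    by (rule vec.linear_add[OF r] vec.linear_add[OF l]
        vec.linear_scale[OF r] vec.linear_scale[OF l])+
qed

lemma linear_vecI:
  fixes f :: "complex^'m \<Rightarrow> complex^'n"
  assumes "\<And>x y. f (x + y) = f x + f y" "\<And>c x. f (c *s x) = c *s f x"
  shows "Vector_Spaces.linear (*s) (*s) f"
  using assms by unfold_locales auto


section \<open>Dendriform algebras and the D-equation\<close>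

definition dendriform_algebra ::
  "(complex^'n \<Rightarrow> complex^'n \<Rightarrow> complex^'n) \<Rightarrow> (complex^'n \<Rightarrow> complex^'n \<Rightarrow> complex^'n) \<Rightarrow> bool" where
  "dendriform_algebra prec succ \<longleftrightarrow>
     bilinear_over (*s) (*s) (*s) prec \<and> bilinear_over (*s) (*s) (*s) succ \<and>
     (\<forall>x y z. prec (prec x y) z = prec x (prec y z + succ y z)) \<and>
     (\<forall>x y z. prec (succ x y) z = succ x (prec y z)) \<and>
     (\<forall>x y z. succ x (succ y z) = succ (prec x y + succ x y) z)"

text \<open>
  The tensor product of \<open>complex^'m\<close> and \<open>complex^'n\<close> is \<open>complex^('m \<times> 'n)\<close>: the coordinate
  \<open>(i, j)\<close> is the coefficient of \<open>e\<^sub>i \<otimes> e\<^sub>j\<close>. Triple tensors \<open>x \<otimes> y \<otimes> z\<close> are \<open>x \<otimes> (y \<otimes> z)\<close>.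
\<close>

definition tensor :: "complex^'m::finite \<Rightarrow> complex^'n::finite \<Rightarrow> complex^('m \<times> 'n)" (infixr "\<otimes>" 75) where
  "x \<otimes> y = (\<chi> p. x $ fst p * y $ snd p)"

lemma tensor_simps:
  "(x + x') \<otimes> y = x \<otimes> y + x' \<otimes> y" "x \<otimes> (y + y') = x \<otimes> y + x \<otimes> y'"
  "(c *s x) \<otimes> y = c *s (x \<otimes> y)" "x \<otimes> (c *s y) = c *s (x \<otimes> y)"
  by (simp_all add: tensor_def vec_eq_iff algebra_simps)

definition flip :: "complex^('m::finite \<times> 'n::finite) \<Rightarrow> complex^('n \<times> 'm)" where
  "flip r = (\<chi> p. r $ (snd p, fst p))"

lemma flip_add: "flip (r + s) = flip r + flip s"
  and flip_scale: "flip (c *s r) = c *s flip r"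
  and flip_tensor: "flip (x \<otimes> y) = y \<otimes> x"
  by (simp_all add: flip_def tensor_def vec_eq_iff)

definition symmetric_tensor :: "complex^('n::finite \<times> 'n) \<Rightarrow> bool" where
  "symmetric_tensor r \<longleftrightarrow> flip r = r"

text \<open>
  For \<open>G\<close> linear in each argument and \<open>r = \<Sum>\<^sub>i x\<^sub>i \<otimes> y\<^sub>i\<close>, \<open>tensor_square_ext G r\<close> is
  \<open>\<Sum>\<^sub>i\<^sub>,\<^sub>j G x\<^sub>i y\<^sub>i x\<^sub>j y\<^sub>j\<close>. It is defined through the expansion of \<open>r\<close> in the standard basis;
  the lemma \<open>tensor_square_ext_sum\<close> gives the value for an arbitrary expansion.
\<close>

definition tensor_square_ext ::
  "(complex^'m::finite \<Rightarrow> complex^'n::finite \<Rightarrow> complex^'m \<Rightarrow> complex^'n \<Rightarrow> complex^'k) \<Rightarrow>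
     complex^('m \<times> 'n) \<Rightarrow> complex^'k" where
  "tensor_square_ext G r = (\<Sum>p\<in>UNIV. \<Sum>q\<in>UNIV. (r $ p * r $ q) *s
     G (axis (fst p) 1) (axis (snd p) 1) (axis (fst q) 1) (axis (snd q) 1))"

lemma linear_expand:
  fixes f :: "complex^'m \<Rightarrow> complex^'k"
  assumes "Vector_Spaces.linear (*s) (*s) f"
  shows "f x = (\<Sum>i\<in>UNIV. x $ i *s f (axis i 1))"
proof -
  have "f x = f (\<Sum>i\<in>UNIV. x $ i *s axis i 1)"
    by (simp add: basis_expansion)
  also have "\<dots> = (\<Sum>i\<in>UNIV. x $ i *s f (axis i 1))"
    using assms by (simp add: vec.linear_sum vec.linear_scale)
  finally show ?thesis .
qed

lemma tensor_expand:
  fixes g :: "complex^'m \<Rightarrow> complex^'n \<Rightarrow> complex^'k"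
  assumes "bilinear_over (*s) (*s) (*s) g"
  shows "g x y = (\<Sum>p\<in>UNIV. (x \<otimes> y) $ p *s g (axis (fst p) 1) (axis (snd p) 1))"
proof -
  have "g x y = (\<Sum>i\<in>UNIV. x $ i *s g (axis i 1) y)"
    using linear_expand[of "\<lambda>x. g x y" x] assms by (simp add: bilinear_over_def)
  also have "\<dots> = (\<Sum>i\<in>UNIV. \<Sum>j\<in>UNIV. (x $ i * y $ j) *s g (axis i 1) (axis j 1))"
  proof (rule sum.cong[OF refl])
    fix i
    have "g (axis i 1) y = (\<Sum>j\<in>UNIV. y $ j *s g (axis i 1) (axis j 1))"
      using linear_expand[of "g (axis i 1)" y] assms by (simp add: bilinear_over_def)
    then show "x $ i *s g (axis i 1) y
        = (\<Sum>j\<in>UNIV. (x $ i * y $ j) *s g (axis i 1) (axis j 1))"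
      by (simp add: vec.scale_sum_right vector_smult_assoc)
  qed
  also have "\<dots> = (\<Sum>p\<in>UNIV. (x \<otimes> y) $ p *s g (axis (fst p) 1) (axis (snd p) 1))"
    by (simp add: sum.cartesian_product tensor_def case_prod_beta flip: UNIV_Times_UNIV)
  finally show ?thesis .
qed

lemma tensor_square_ext_sum:
  fixes x :: "'i \<Rightarrow> complex^'m" and y :: "'i \<Rightarrow> complex^'n"
    and G :: "complex^'m \<Rightarrow> complex^'n \<Rightarrow> complex^'m \<Rightarrow> complex^'n \<Rightarrow> complex^'k"
  assumes "\<And>u v. bilinear_over (*s) (*s) (*s) (G u v)"
    and "\<And>u v. bilinear_over (*s) (*s) (*s) (\<lambda>x y. G x y u v)"
  shows "tensor_square_ext G (\<Sum>i\<in>I. x i \<otimes> y i)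
           = (\<Sum>i\<in>I. \<Sum>j\<in>I. G (x i) (y i) (x j) (y j))"
proof -
  let ?e = "\<lambda>p. axis (fst p) 1" and ?f = "\<lambda>p. axis (snd p) 1"
  have G: "G a b c d = (\<Sum>p\<in>UNIV. \<Sum>q\<in>UNIV.
      ((a \<otimes> b) $ p * (c \<otimes> d) $ q) *s G (?e p) (?f p) (?e q) (?f q))" for a b c d
  proof -
    have "G a b c d = (\<Sum>p\<in>UNIV. (a \<otimes> b) $ p *s G (?e p) (?f p) c d)"
      by (rule tensor_expand[OF assms(2)])
    also have "\<dots> = (\<Sum>p\<in>UNIV. (a \<otimes> b) $ p *s
        (\<Sum>q\<in>UNIV. (c \<otimes> d) $ q *s G (?e p) (?f p) (?e q) (?f q)))"
      by (rule sum.cong[OF refl], subst tensor_expand[OF assms(1)], rule refl)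
    finally show ?thesis
      by (simp add: vec.scale_sum_right vector_smult_assoc)
  qed
  let ?H = "\<lambda>p q. G (?e p) (?f p) (?e q) (?f q)"
  have "tensor_square_ext G (\<Sum>i\<in>I. x i \<otimes> y i) = (\<Sum>p\<in>UNIV. \<Sum>q\<in>UNIV. \<Sum>i\<in>I. \<Sum>j\<in>I.
      ((x i \<otimes> y i) $ p * (x j \<otimes> y j) $ q) *s ?H p q)"
    by (simp add: tensor_square_ext_def sum_product vec.scale_sum_left)
  also have "\<dots> = (\<Sum>p\<in>UNIV. \<Sum>i\<in>I. \<Sum>q\<in>UNIV. \<Sum>j\<in>I.
      ((x i \<otimes> y i) $ p * (x j \<otimes> y j) $ q) *s ?H p q)"
    by (rule sum.cong[OF refl], rule sum.swap)
  also have "\<dots> = (\<Sum>i\<in>I. \<Sum>p\<in>UNIV. \<Sum>j\<in>I. \<Sum>q\<in>UNIV.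
      ((x i \<otimes> y i) $ p * (x j \<otimes> y j) $ q) *s ?H p q)"
    by (subst sum.swap, intro sum.cong refl, rule sum.swap)
  also have "\<dots> = (\<Sum>i\<in>I. \<Sum>j\<in>I. \<Sum>p\<in>UNIV. \<Sum>q\<in>UNIV.
      ((x i \<otimes> y i) $ p * (x j \<otimes> y j) $ q) *s ?H p q)"
    by (rule sum.cong[OF refl], rule sum.swap)
  finally show ?thesis
    by (simp flip: G)
qed

text \<open>
  The equation \<open>r\<^sub>1\<^sub>2 \<ast> r\<^sub>1\<^sub>3 = r\<^sub>1\<^sub>3 \<prec> r\<^sub>2\<^sub>3 + r\<^sub>2\<^sub>3 \<succ> r\<^sub>1\<^sub>2\<close>; the bound variables \<open>x y x' y'\<close>
  stand for \<open>x\<^sub>i, y\<^sub>i, x\<^sub>j, y\<^sub>j\<close>.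
\<close>

definition D_equation ::
  "(complex^'n::finite \<Rightarrow> complex^'n \<Rightarrow> complex^'n) \<Rightarrow> (complex^'n \<Rightarrow> complex^'n \<Rightarrow> complex^'n) \<Rightarrow>
     complex^('n \<times> 'n) \<Rightarrow> bool" where
  "D_equation prec succ r \<longleftrightarrow>
     tensor_square_ext (\<lambda>x y x' y'. (prec x x' + succ x x') \<otimes> y \<otimes> y') r =
       tensor_square_ext (\<lambda>x y x' y'. x \<otimes> x' \<otimes> prec y y') r +
       tensor_square_ext (\<lambda>x y x' y'. x' \<otimes> succ x y' \<otimes> y) r"

lemma D_equation_sum:
  fixes x y :: "'i \<Rightarrow> complex^'n"
  assumes "dendriform_algebra prec succ"
  shows "D_equation prec succ (\<Sum>i\<in>I. x i \<otimes> y i) \<longleftrightarrow>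
     (\<Sum>i\<in>I. \<Sum>j\<in>I. (prec (x i) (x j) + succ (x i) (x j)) \<otimes> y i \<otimes> y j) =
       (\<Sum>i\<in>I. \<Sum>j\<in>I. x i \<otimes> x j \<otimes> prec (y i) (y j)) +
       (\<Sum>i\<in>I. \<Sum>j\<in>I. x j \<otimes> succ (x i) (y j) \<otimes> y i)"
proof -
  have "bilinear_over (*s) (*s) (*s) prec" and "bilinear_over (*s) (*s) (*s) succ"
    using assms by (auto simp: dendriform_algebra_def)
  note lin = this[THEN bilinear_over_simps(1)] this[THEN bilinear_over_simps(2)]
    this[THEN bilinear_over_simps(3)] this[THEN bilinear_over_simps(4)]
  note rules = bilinear_over_def linear_vecI lin tensor_simps vec.scale_right_distrib add_ac
  have 1: "tensor_square_ext (\<lambda>x y x' y'. (prec x x' + succ x x') \<otimes> y \<otimes> y') (\<Sum>i\<in>I. x i \<otimes> y i)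
      = (\<Sum>i\<in>I. \<Sum>j\<in>I. (prec (x i) (x j) + succ (x i) (x j)) \<otimes> y i \<otimes> y j)"
    by (rule tensor_square_ext_sum) (simp_all add: rules)
  have 2: "tensor_square_ext (\<lambda>x y x' y'. x \<otimes> x' \<otimes> prec y y') (\<Sum>i\<in>I. x i \<otimes> y i)
      = (\<Sum>i\<in>I. \<Sum>j\<in>I. x i \<otimes> x j \<otimes> prec (y i) (y j))"
    by (rule tensor_square_ext_sum) (simp_all add: rules)
  have 3: "tensor_square_ext (\<lambda>x y x' y'. x' \<otimes> succ x y' \<otimes> y) (\<Sum>i\<in>I. x i \<otimes> y i)
      = (\<Sum>i\<in>I. \<Sum>j\<in>I. x j \<otimes> succ (x i) (y j) \<otimes> y i)"
    by (rule tensor_square_ext_sum) (simp_all add: rules)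
  show ?thesis
    unfolding D_equation_def 1 2 3 ..
qed


section \<open>Linear forms and the direct sum of a space with its dual\<close>

typedef (overloaded) 'n linear_form =
  "{f :: complex^'n::finite \<Rightarrow> complex. Vector_Spaces.linear (*s) (*) f}"
  morphisms form_apply Abs_linear_form
proof -
  have "Vector_Spaces.linear (*s) (*) (\<lambda>x::complex^'n. 0)"
    by unfold_locales (auto simp: algebra_simps)
  then show ?thesis by blast
qed

setup_lifting type_definition_linear_form

lemma linear_form_iff:
  "Vector_Spaces.linear (*s) (*) (f :: complex^'n \<Rightarrow> complex) \<longleftrightarrow>
     (\<forall>x y. f (x + y) = f x + f y) \<and> (\<forall>c x. f (c *s x) = c * f x)"
proof
  assume "Vector_Spaces.linear (*s) (*) f"
  then interpret f: Vector_Spaces.linear "(*s)" "(*)" f .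
  show "(\<forall>x y. f (x + y) = f x + f y) \<and> (\<forall>c x. f (c *s x) = c * f x)"
    by (simp add: f.add f.scale)
qed (unfold_locales, auto simp: algebra_simps)

instantiation linear_form :: (finite) ab_group_add
begin

lift_definition zero_linear_form :: "'a linear_form" is "\<lambda>_. 0"
  by (simp add: linear_form_iff)
lift_definition plus_linear_form :: "'a linear_form \<Rightarrow> 'a linear_form \<Rightarrow> 'a linear_form"
  is "\<lambda>f g x. f x + g x"
  by (simp add: linear_form_iff algebra_simps)
lift_definition uminus_linear_form :: "'a linear_form \<Rightarrow> 'a linear_form"
  is "\<lambda>f x. - f x"
  by (simp add: linear_form_iff)
lift_definition minus_linear_form :: "'a linear_form \<Rightarrow> 'a linear_form \<Rightarrow> 'a linear_form"
  is "\<lambda>f g x. f x - g x"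
  by (simp add: linear_form_iff algebra_simps)

instance by standard (transfer; auto)+

end

lift_definition form_scale :: "complex \<Rightarrow> 'n::finite linear_form \<Rightarrow> 'n linear_form"
  is "\<lambda>c f x. c * f x"
  by (simp add: linear_form_iff algebra_simps)

lift_definition dual_basis :: "'n::finite \<Rightarrow> 'n linear_form" is "\<lambda>i x. x $ i"
  by (simp add: linear_form_iff)

lemma dual_basis_axis: "form_apply (dual_basis i) (axis j 1) = (if i = j then 1 else 0)"
  by transfer (simp add: axis_def)

type_synonym 'n double = "(complex^'n) \<times> 'n linear_form"

definition double_scale :: "complex \<Rightarrow> 'n::finite double \<Rightarrow> 'n double" (infixr "\<bullet>\<^sub>d" 75) where
  "c \<bullet>\<^sub>d u = (c *s fst u, form_scale c (snd u))"

lemma vector_space_double: "vector_space (double_scale :: complex \<Rightarrow> 'n::finite double \<Rightarrow> _)"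
  by unfold_locales (auto simp: double_scale_def vec_eq_iff algebra_simps; transfer; simp add: algebra_simps)+

definition natural_form :: "'n::finite double \<Rightarrow> 'n double \<Rightarrow> complex" where
  "natural_form u v = - form_apply (snd v) (fst u) + form_apply (snd u) (fst v)"

definition Connes_cocycle :: "('a \<Rightarrow> 'a \<Rightarrow> 'a) \<Rightarrow> ('a \<Rightarrow> 'a \<Rightarrow> complex) \<Rightarrow> bool" where
  "Connes_cocycle mul \<omega> \<longleftrightarrow>
     (\<forall>u v w. \<omega> (mul u v) w + \<omega> (mul v w) u + \<omega> (mul w u) v = 0)"

definition Connes_double_construction ::
  "(complex^'n \<Rightarrow> complex^'n \<Rightarrow> complex^'n) \<Rightarrow>
     ('n::finite double \<Rightarrow> 'n double \<Rightarrow> 'n double) \<Rightarrow> bool" where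
  "Connes_double_construction mulA mul \<longleftrightarrow>
     bilinear_over double_scale double_scale double_scale mul \<and>
     (\<forall>u v w. mul (mul u v) w = mul u (mul v w)) \<and>
     (\<forall>x y. mul (x, 0) (y, 0) = (mulA x y, 0)) \<and>
     (\<forall>a b. fst (mul (0, a) (0, b)) = 0) \<and>
     Connes_cocycle mul natural_form"

text \<open>
  \<open>Inl i\<close> indexes the basis vector \<open>e\<^sub>i\<close> and \<open>Inr i\<close> the dual basis vector \<open>e\<^sub>i\<^sup>*\<close>.
\<close>

fun double_basis :: "'n + 'n \<Rightarrow> 'n::finite double" where
  "double_basis (Inl i) = (axis i 1, 0)"
| "double_basis (Inr i) = (0, dual_basis i)"

fun double_coord :: "'n::finite double \<Rightarrow> 'n + 'n \<Rightarrow> complex" where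
  "double_coord u (Inl i) = fst u $ i"
| "double_coord u (Inr i) = form_apply (snd u) (axis i 1)"

lemma double_coord_basis: "double_coord (double_basis p) q = (if p = q then 1 else 0)"
proof (cases p; cases q)
qed (auto simp: axis_def zero_linear_form.rep_eq dual_basis.rep_eq)

text \<open>
  The bilinear product with the given multiplication table of basis vectors; products of basis
  vectors that are missing from the table are zero.
\<close>

definition table_product ::
  "((('n + 'n) \<times> ('n + 'n)) \<times> 'n::finite double) list \<Rightarrow> 'n double \<Rightarrow> 'n double \<Rightarrow> 'n double" where
  "table_product tab u v = (\<Sum>p\<in>UNIV. \<Sum>q\<in>UNIV.
     (double_coord u p * double_coord v q) \<bullet>\<^sub>d
       (case map_of tab (p, q) of None \<Rightarrow> 0 | Some w \<Rightarrow> w))"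

lemma double_scale_one: "1 \<bullet>\<^sub>d u = u" and double_scale_zero: "0 \<bullet>\<^sub>d u = 0"
  by (simp_all add: double_scale_def prod_eq_iff, (transfer; simp)+)

lemma table_product_basis:
  "table_product tab (double_basis p) (double_basis q)
     = (case map_of tab (p, q) of None \<Rightarrow> 0 | Some w \<Rightarrow> w)"
proof -
  have *: "((if p = p' then 1 else 0) * (if q = q' then 1 else (0::complex))) \<bullet>\<^sub>d w
      = (if q = q' then if p = p' then w else 0 else 0)" for p' q' w
    by (simp add: double_scale_one double_scale_zero)
  show ?thesis
    unfolding table_product_def double_coord_basis * by simp
qed


lemma bilinear_table_product:
  "bilinear_over double_scale double_scale double_scale (table_product tab)"
proof -
  interpret d: vector_space "double_scale :: complex \<Rightarrow> 'a double \<Rightarrow> 'a double"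
    by (rule vector_space_double)
  have coord: "double_coord (u + v) p = double_coord u p + double_coord v p"
    "double_coord (c \<bullet>\<^sub>d u) p = c * double_coord u p" for u v :: "'a double" and c p
    by (cases p; simp add: double_scale_def plus_linear_form.rep_eq form_scale.rep_eq)+
  show ?thesis
    unfolding bilinear_over_def table_product_def
    by (intro conjI allI; unfold_locales;
      simp add: coord d.scale_left_distrib d.scale_sum_right sum.distrib algebra_simps)
qed


section \<open>The algebra \<open>H\<^sub>0\<close>\<close>

text \<open>
  \<open>e\<^sub>i\<close> is \<open>axis i 1\<close>; the index type \<open>3\<close> has the elements \<open>1\<close>, \<open>2\<close>, \<open>3\<close>.
\<close>

definition H0_mult :: "complex^3 \<Rightarrow> complex^3 \<Rightarrow> complex^3" where
  "H0_mult x y = (x $ 1 * y $ 3) *s axis 2 1"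

definition H0_prec :: "complex \<Rightarrow> complex^3 \<Rightarrow> complex^3 \<Rightarrow> complex^3" where
  "H0_prec l x y = (1 - l) *s H0_mult x y"

definition H0_succ :: "complex \<Rightarrow> complex^3 \<Rightarrow> complex^3 \<Rightarrow> complex^3" where
  "H0_succ l x y = l *s H0_mult x y"

lemma H0_prec_plus_succ: "H0_prec l x y + H0_succ l x y = H0_mult x y"
  by (simp add: H0_prec_def H0_succ_def flip: vector_sadd_rdistrib)

lemma H0_mult_basis:
  "H0_mult (axis i 1) (axis j 1) = (if i = 1 \<and> j = 3 then axis 2 1 else 0)"
  by (auto simp: H0_mult_def axis_def)

lemma dendriform_H0: "dendriform_algebra (H0_prec l) (H0_succ l)"
  by (auto simp: dendriform_algebra_def bilinear_over_def H0_prec_def H0_succ_def H0_mult_def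
      vec_eq_iff axis_def algebra_simps intro!: linear_vecI)

abbreviation e :: "3 \<Rightarrow> complex^3" where "e i \<equiv> axis i 1"

abbreviation E :: "3 \<Rightarrow> 3 double" where "E i \<equiv> double_basis (Inl i)"
abbreviation E' :: "3 \<Rightarrow> 3 double" where "E' i \<equiv> double_basis (Inr i)"

end

theory Submission
  imports Defs
begin

text \<open>Everything is compared coordinatewise. Since \<open>e 1\<close> times \<open>e 3\<close>
  is the only nonzero product in the algebra, each term of the D-equation is a product of two
  coefficients of \<open>r\<close>, one with an index 1 and one with an index 3
  (\<open>D_equation_H0_iff\<close>). If \<open>r\<close> lies in the tensor square of the span of
  \<open>e 1\<close>, \<open>e 2\<close>, or of \<open>e 2\<close>, \<open>e 3\<close>, all three
  terms vanish. In the mixed case only the coefficient at (2, 2, 2) survives, and it reads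
  \<open>a12 * a23 = (1 - l) * (a12 * a23) + l * (a12 * a23)\<close>.

  For the doubles, \<open>double_coord_table_product\<close> turns the product into a short explicit
  bilinear expression. Each table describes an algebra in which all triple products vanish: the
  listed values annihilate the whole double from both sides. So associativity holds with both sides
  zero. The cocycle identity is a cancellation between weights: on \<open>E 1\<close>,
  \<open>E 3\<close>, \<open>E' 2\<close>, for instance, it is
  \<open>- 1 + (1 - l) + l = 0\<close>.\<close>

section \<open>Coordinate forms of the product, the natural form and the D-equation\<close>

lemma double_coord_linear [simp]:
  "double_coord 0 p = 0"
  "double_coord (u + v) p = double_coord u p + double_coord v p"
  "double_coord (c \<bullet>\<^sub>d u) p = c * double_coord u p"
  by (cases p; simp add: double_scale_def zero_linear_form.rep_eq plus_linear_form.rep_eq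
      form_scale.rep_eq)+

lemma double_coord_sum: "double_coord (sum f A) p = (\<Sum>i\<in>A. double_coord (f i) p)"
  by (induction A rule: infinite_finite_induct) auto

lemma form_apply_expand: "form_apply f x = (\<Sum>i\<in>UNIV. x $ i * form_apply f (axis i 1))"
proof -
  interpret f: Vector_Spaces.linear "(*s)" "(*)" "form_apply f"
    using form_apply[of f] by simp
  have "form_apply f x = form_apply f (\<Sum>i\<in>UNIV. x $ i *s axis i 1)"
    by (simp add: basis_expansion)
  then show ?thesis
    by (simp add: f.sum f.scale)
qed

text \<open>A linear form is determined by its values on the standard basis, so the six coordinates
  separate points when the index type is \<open>3\<close>. Identities in the double thereby become
  identities between complex polynomials.\<close>

lemma double_eq_iff: "u = v \<longleftrightarrow> (\<forall>p. double_coord u p = double_coord v p)"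
proof
  assume *: "\<forall>p. double_coord u p = double_coord v p"
  have "fst u $ i = fst v $ i" for i
    using *[rule_format, of "Inl i"] by simp
  moreover have "form_apply (snd u) (axis i 1) = form_apply (snd v) (axis i 1)" for i
    using *[rule_format, of "Inr i"] by simp
  then have "form_apply (snd u) = form_apply (snd v)"
    by (intro ext) (subst (1 2) form_apply_expand, simp)
  ultimately show "u = v"
    by (simp add: prod_eq_iff vec_eq_iff form_apply_inject)
qed simp

lemma natural_form_coord:
  "natural_form u v =
     (\<Sum>i\<in>UNIV. double_coord u (Inr i) * double_coord v (Inl i)
        - double_coord u (Inl i) * double_coord v (Inr i))"
  unfolding natural_form_def
  by (subst (1 2) form_apply_expand) (simp add: sum_subtractf mult.commute)

text \<open>Replaces the double sum over all pairs of basis indices by a sum over the listed entries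
  only. Distinct keys matter because \<open>map_of\<close> reads only the first entry for a key,
  whereas the list sum counts every one.\<close>

lemma double_coord_table_product:
  assumes "distinct (map fst tab)"
  shows "double_coord (table_product tab u v) k =
    (\<Sum>(pq, w)\<leftarrow>tab. double_coord u (fst pq) * double_coord v (snd pq) * double_coord w k)"
  using assms
proof (induction tab)
  case Nil
  then show ?case
    by (simp add: table_product_def double_coord_sum)
next
  case (Cons t tab)
  obtain p q w where t: "t = ((p, q), w)"
    by (metis prod.collapse)
  have new: "map_of tab (p, q) = None"
    using Cons.prems by (auto simp: t map_of_eq_None_iff)
  let ?c = "\<lambda>tab p q. double_coord u p * double_coord v q *
    double_coord (case map_of tab (p, q) of None \<Rightarrow> 0 | Some w \<Rightarrow> w) k"
  have expand: "double_coord (table_product tab u v) k = (\<Sum>p\<in>UNIV. \<Sum>q\<in>UNIV. ?c tab p q)" for tab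
    by (simp add: table_product_def double_coord_sum)
  \<comment> \<open>The new key contributes one extra summand. The nested conditionals follow the
    order of summation, so that each sum over an index collapses to a single term.\<close>
  have step: "?c (t # tab) p' q' = ?c tab p' q' +
      (if q' = q then if p' = p then double_coord u p * double_coord v q * double_coord w k
        else 0 else 0)" for p' q'
    using new by (auto simp: t)
  have "double_coord (table_product (t # tab) u v) k =
      double_coord (table_product tab u v) k + double_coord u p * double_coord v q * double_coord w k"
    unfolding expand step sum.distrib by simp
  then show ?case
    using Cons by (simp add: t)
qed

text \<open>A product of two vectors of the algebra is a multiple of \<open>e 2\<close>, so each
  term is supported where its multiplied slot has index 2. Its two factors in \<open>r\<close>
  supply \<open>e 1\<close> and \<open>e 3\<close> to that slot, and the remaining indices pass
  through.\<close>

lemma D_equation_H0_iff: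
  "D_equation (H0_prec l) (H0_succ l) r \<longleftrightarrow>
     (\<forall>i j k. (if i = 2 then r $ (1, j) * r $ (3, k) else 0) =
       (if k = 2 then (1 - l) * (r $ (i, 1) * r $ (j, 3)) else 0) +
       (if j = 2 then l * (r $ (1, k) * r $ (i, 3)) else 0))"
proof -
  have UNIV_prod: "(\<Sum>p\<in>UNIV. f p) = (\<Sum>i\<in>UNIV. \<Sum>j\<in>UNIV. f (i, j))"
    for f :: "3 \<times> 3 \<Rightarrow> complex"
    by (simp add: sum.cartesian_product flip: UNIV_Times_UNIV)
  have "tensor_square_ext (\<lambda>x y x' y'. (H0_prec l x x' + H0_succ l x x') \<otimes> y \<otimes> y') r $ (i, j, k)
      = (if i = 2 then r $ (1, j) * r $ (3, k) else 0)"
    and "tensor_square_ext (\<lambda>x y x' y'. x \<otimes> x' \<otimes> H0_prec l y y') r $ (i, j, k)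
      = (if k = 2 then (1 - l) * (r $ (i, 1) * r $ (j, 3)) else 0)"
    and "tensor_square_ext (\<lambda>x y x' y'. x' \<otimes> H0_succ l x y' \<otimes> y) r $ (i, j, k)
      = (if j = 2 then l * (r $ (1, k) * r $ (i, 3)) else 0)" for i j k
    using exhaust_3[of i] exhaust_3[of j] exhaust_3[of k]
    by (auto simp: tensor_square_ext_def H0_prec_plus_succ tensor_def H0_prec_def H0_succ_def
        H0_mult_def axis_def UNIV_prod sum_3)
  then show ?thesis
    by (simp add: D_equation_def vec_eq_iff)
qed

text \<open>Bilinearity is automatic for a table product; the other algebraic conditions are stated
  in coordinates, ready for polynomial arithmetic.\<close>

lemma Connes_double_construction_H0I:
  assumes "\<And>u v w. \<forall>p. double_coord (table_product tab (table_product tab u v) w) p =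
      double_coord (table_product tab u (table_product tab v w)) p"
    and "\<And>x y. \<forall>p. double_coord (table_product tab (x, 0) (y, 0)) p =
      double_coord (H0_mult x y, 0) p"
    and "\<And>a b i. double_coord (table_product tab (0, a) (0, b)) (Inl i) = 0"
    and "Connes_cocycle (table_product tab) natural_form"
  shows "Connes_double_construction H0_mult (table_product tab)"
  using assms unfolding Connes_double_construction_def
  by (simp add: bilinear_table_product double_eq_iff vec_eq_iff)

lemma forall_sum_3: "(\<forall>p :: 3 + 3. P p) \<longleftrightarrow>
    P (Inl 1) \<and> P (Inl 2) \<and> P (Inl 3) \<and> P (Inr 1) \<and> P (Inr 2) \<and> P (Inr 3)"
  by (simp add: split_sum_all forall_3 conj_assoc)

section \<open>The three families of symmetric solutions\<close>

lemma D_solution_span_e1_e2: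
  "let r = a11 *s (e 1 \<otimes> e 1) + a12 *s (e 1 \<otimes> e 2 + e 2 \<otimes> e 1) + a22 *s (e 2 \<otimes> e 2)
   in symmetric_tensor r \<and> D_equation (H0_prec l) (H0_succ l) r"
proof -
  define r where "r = a11 *s (e 1 \<otimes> e 1) + a12 *s (e 1 \<otimes> e 2 + e 2 \<otimes> e 1) + a22 *s (e 2 \<otimes> e 2)"
  have "symmetric_tensor r"
    by (simp add: r_def symmetric_tensor_def flip_add flip_scale flip_tensor add_ac)
  moreover have comps:
    "r $ (1, 1) = a11" "r $ (1, 2) = a12" "r $ (1, 3) = 0"
    "r $ (2, 1) = a12" "r $ (2, 2) = a22" "r $ (2, 3) = 0"
    "r $ (3, 1) = 0" "r $ (3, 2) = 0" "r $ (3, 3) = 0"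
    by (simp_all add: r_def tensor_def axis_def)
  have "D_equation (H0_prec l) (H0_succ l) r"
    by (simp add: D_equation_H0_iff forall_3 comps algebra_simps)
  ultimately show ?thesis
    by (simp add: r_def)
qed

lemma D_solution_span_e2_e3:
  "let r = a22 *s (e 2 \<otimes> e 2) + a23 *s (e 2 \<otimes> e 3 + e 3 \<otimes> e 2) + a33 *s (e 3 \<otimes> e 3)
   in symmetric_tensor r \<and> D_equation (H0_prec l) (H0_succ l) r"
proof -
  define r where "r = a22 *s (e 2 \<otimes> e 2) + a23 *s (e 2 \<otimes> e 3 + e 3 \<otimes> e 2) + a33 *s (e 3 \<otimes> e 3)"
  have "symmetric_tensor r"
    by (simp add: r_def symmetric_tensor_def flip_add flip_scale flip_tensor add_ac)
  moreover have comps: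
    "r $ (1, 1) = 0" "r $ (1, 2) = 0" "r $ (1, 3) = 0"
    "r $ (2, 1) = 0" "r $ (2, 2) = a22" "r $ (2, 3) = a23"
    "r $ (3, 1) = 0" "r $ (3, 2) = a23" "r $ (3, 3) = a33"
    by (simp_all add: r_def tensor_def axis_def)
  have "D_equation (H0_prec l) (H0_succ l) r"
    by (simp add: D_equation_H0_iff forall_3 comps algebra_simps)
  ultimately show ?thesis
    by (simp add: r_def)
qed

lemma D_solution_mixed:
  "let r = a12 *s (e 1 \<otimes> e 2 + e 2 \<otimes> e 1) + a22 *s (e 2 \<otimes> e 2) + a23 *s (e 2 \<otimes> e 3 + e 3 \<otimes> e 2)
   in symmetric_tensor r \<and> D_equation (H0_prec l) (H0_succ l) r"
proof -
  define r where "r = a12 *s (e 1 \<otimes> e 2 + e 2 \<otimes> e 1) + a22 *s (e 2 \<otimes> e 2) + a23 *s (e 2 \<otimes> e 3 + e 3 \<otimes> e 2)"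
  have "symmetric_tensor r"
    by (simp add: r_def symmetric_tensor_def flip_add flip_scale flip_tensor add_ac)
  moreover have comps:
    "r $ (1, 1) = 0" "r $ (1, 2) = a12" "r $ (1, 3) = 0"
    "r $ (2, 1) = a12" "r $ (2, 2) = a22" "r $ (2, 3) = a23"
    "r $ (3, 1) = 0" "r $ (3, 2) = a23" "r $ (3, 3) = 0"
    by (simp_all add: r_def tensor_def axis_def)
  have "D_equation (H0_prec l) (H0_succ l) r"
    by (simp add: D_equation_H0_iff forall_3 comps algebra_simps)
  ultimately show ?thesis
    by (simp add: r_def)
qed

section \<open>The three double constructions\<close>

text \<open>\<open>E 2\<close> and \<open>E' 3\<close> occur in no key, so they annihilate
  everything. So does \<open>a11 \<bullet>\<^sub>d E 1 + E' 1 + a12 \<bullet>\<^sub>d E 2\<close>: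
  its products with \<open>E 3\<close> on the right and with \<open>E' 2\<close> on the left cancel
  between \<open>E 1\<close> and \<open>E' 1\<close>.\<close>

lemma Connes_double_span_e1_e2:
  "Connes_double_construction H0_mult (table_product
     [((Inl 1, Inl 3), E 2),
      ((Inr 2, Inr 2), (- a12 * l) \<bullet>\<^sub>d E' 3),
      ((Inr 2, Inl 1), l \<bullet>\<^sub>d E' 3),
      ((Inr 2, Inl 3), (- a12) \<bullet>\<^sub>d E 2),
      ((Inr 2, Inr 1), (- a11 * l) \<bullet>\<^sub>d E' 3),
      ((Inr 1, Inl 3), (- a11) \<bullet>\<^sub>d E 2),
      ((Inl 3, Inr 2), (a11 * (1 - l)) \<bullet>\<^sub>d E 1 + (1 - l) \<bullet>\<^sub>d E' 1 + ((1 - l) * a12) \<bullet>\<^sub>d E 2)])"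
  (is "Connes_double_construction _ (table_product ?tab)")
proof -
  define tab where "tab = ?tab"
  have coord: "double_coord (table_product tab u v) k =
      (\<Sum>(pq, w)\<leftarrow>?tab. double_coord u (fst pq) * double_coord v (snd pq) * double_coord w k)"
    for u v k
    unfolding tab_def by (rule double_coord_table_product) simp
  have "Connes_double_construction H0_mult (table_product tab)"
  proof (rule Connes_double_construction_H0I)
    show "\<forall>p. double_coord (table_product tab (table_product tab u v) w) p =
        double_coord (table_product tab u (table_product tab v w)) p" for u v w
      unfolding forall_sum_3
      \<comment> \<open>Deleting the defining equations keeps the coordinates of \<open>u\<close>,
        \<open>v\<close>, \<open>w\<close> as atoms, so that \<open>coord\<close> can be applied to
        the nested products as well.\<close>
      by (simp add: coord double_coord_basis algebra_simps del: double_basis.simps double_coord.simps)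
    show "\<forall>p. double_coord (table_product tab (x, 0) (y, 0)) p = double_coord (H0_mult x y, 0) p"
      for x y
      unfolding forall_sum_3
      by (simp add: coord double_coord_basis del: double_basis.simps double_coord.simps)
        (simp add: H0_mult_def axis_def zero_linear_form.rep_eq)
    show "double_coord (table_product tab (0, a) (0, b)) (Inl i) = 0" for a b i
      \<comment> \<open>The second \<open>simp\<close> restores the defining equations: entries with
        an \<open>Inl\<close> factor then vanish on \<open>(0, a)\<close>, \<open>(0, b)\<close>,
        and the entries with two \<open>Inr\<close> factors have values in the dual part.\<close>
      by (simp add: coord double_coord_basis del: double_basis.simps double_coord.simps) simp
    show "Connes_cocycle (table_product tab) natural_form"
      by (simp add: Connes_cocycle_def natural_form_coord sum_3 coord double_coord_basis
          algebra_simps del: double_basis.simps double_coord.simps)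
  qed
  then show ?thesis
    by (simp only: tab_def)
qed

text \<open>Here \<open>E 2\<close> and \<open>E' 1\<close> occur in no key. The vector
  \<open>a23 \<bullet>\<^sub>d E 2 + a33 \<bullet>\<^sub>d E 3 + E' 3\<close> also annihilates
  everything: multiplied by \<open>E 1\<close> on the left or by \<open>E' 2\<close> on the right,
  the contributions of \<open>E 3\<close> and \<open>E' 3\<close> cancel.\<close>

lemma Connes_double_span_e2_e3:
  "Connes_double_construction H0_mult (table_product
     [((Inl 1, Inl 3), E 2),
      ((Inr 2, Inr 2), ((l - 1) * a23) \<bullet>\<^sub>d E' 1),
      ((Inl 1, Inr 2), (- a23) \<bullet>\<^sub>d E 2),
      ((Inl 3, Inr 2), (1 - l) \<bullet>\<^sub>d E' 1),
      ((Inr 3, Inr 2), ((l - 1) * a33) \<bullet>\<^sub>d E' 1),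
      ((Inl 1, Inr 3), (- a33) \<bullet>\<^sub>d E 2),
      ((Inr 2, Inl 1), l \<bullet>\<^sub>d (a23 \<bullet>\<^sub>d E 2 + a33 \<bullet>\<^sub>d E 3 + E' 3))])"
  (is "Connes_double_construction _ (table_product ?tab)")
proof -
  define tab where "tab = ?tab"
  have coord: "double_coord (table_product tab u v) k =
      (\<Sum>(pq, w)\<leftarrow>?tab. double_coord u (fst pq) * double_coord v (snd pq) * double_coord w k)"
    for u v k
    unfolding tab_def by (rule double_coord_table_product) simp
  have "Connes_double_construction H0_mult (table_product tab)"
  proof (rule Connes_double_construction_H0I)
    show "\<forall>p. double_coord (table_product tab (table_product tab u v) w) p =
        double_coord (table_product tab u (table_product tab v w)) p" for u v w
      unfolding forall_sum_3
      by (simp add: coord double_coord_basis algebra_simps del: double_basis.simps double_coord.simps)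
    show "\<forall>p. double_coord (table_product tab (x, 0) (y, 0)) p = double_coord (H0_mult x y, 0) p"
      for x y
      unfolding forall_sum_3
      by (simp add: coord double_coord_basis del: double_basis.simps double_coord.simps)
        (simp add: H0_mult_def axis_def zero_linear_form.rep_eq)
    show "double_coord (table_product tab (0, a) (0, b)) (Inl i) = 0" for a b i
      by (simp add: coord double_coord_basis del: double_basis.simps double_coord.simps) simp
    show "Connes_cocycle (table_product tab) natural_form"
      by (simp add: Connes_cocycle_def natural_form_coord sum_3 coord double_coord_basis
          algebra_simps del: double_basis.simps double_coord.simps)
  qed
  then show ?thesis
    by (simp only: tab_def)
qed

text \<open>All values lie in the span of \<open>E 2\<close>, \<open>E' 1\<close> and
  \<open>E' 3\<close>, none of which occurs in a key, so triple products vanish without any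
  cancellation.\<close>

lemma Connes_double_mixed:
  "Connes_double_construction H0_mult (table_product
     [((Inl 1, Inl 3), E 2),
      ((Inr 2, Inr 2), (a23 * (l - 1)) \<bullet>\<^sub>d E' 1),
      ((Inr 2, Inl 3), (a12 * (l - 1)) \<bullet>\<^sub>d E 2),
      ((Inl 1, Inr 2), (- a23) \<bullet>\<^sub>d E 2),
      ((Inl 3, Inr 2), (1 - l) \<bullet>\<^sub>d (a12 \<bullet>\<^sub>d E 2 + E' 1)),
      ((Inr 2, Inl 1), l \<bullet>\<^sub>d (a23 \<bullet>\<^sub>d E 2 + E' 3))])"
  (is "Connes_double_construction _ (table_product ?tab)")
proof -
  define tab where "tab = ?tab"
  have coord: "double_coord (table_product tab u v) k =
      (\<Sum>(pq, w)\<leftarrow>?tab. double_coord u (fst pq) * double_coord v (snd pq) * double_coord w k)"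
    for u v k
    unfolding tab_def by (rule double_coord_table_product) simp
  have "Connes_double_construction H0_mult (table_product tab)"
  proof (rule Connes_double_construction_H0I)
    show "\<forall>p. double_coord (table_product tab (table_product tab u v) w) p =
        double_coord (table_product tab u (table_product tab v w)) p" for u v w
      unfolding forall_sum_3
      by (simp add: coord double_coord_basis algebra_simps del: double_basis.simps double_coord.simps)
    show "\<forall>p. double_coord (table_product tab (x, 0) (y, 0)) p = double_coord (H0_mult x y, 0) p"
      for x y
      unfolding forall_sum_3
      by (simp add: coord double_coord_basis del: double_basis.simps double_coord.simps)
        (simp add: H0_mult_def axis_def zero_linear_form.rep_eq)
    show "double_coord (table_product tab (0, a) (0, b)) (Inl i) = 0" for a b i
      by (simp add: coord double_coord_basis del: double_basis.simps double_coord.simps) simp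
    show "Connes_cocycle (table_product tab) natural_form"
      by (simp add: Connes_cocycle_def natural_form_coord sum_3 coord double_coord_basis
          algebra_simps del: double_basis.simps double_coord.simps)
  qed
  then show ?thesis
    by (simp only: tab_def)
qed

theorem proposition4p3:
  fixes l a11 a12 a22 a23 a33 :: complex
  shows
    "((let r = a11 *s (e 1 \<otimes> e 1) + a12 *s (e 1 \<otimes> e 2 + e 2 \<otimes> e 1) + a22 *s (e 2 \<otimes> e 2)
      in symmetric_tensor r \<and> D_equation (H0_prec l) (H0_succ l) r) \<and>
     Connes_double_construction H0_mult (table_product
       [((Inl 1, Inl 3), E 2),
        ((Inr 2, Inr 2), (- a12 * l) \<bullet>\<^sub>d E' 3),
        ((Inr 2, Inl 1), l \<bullet>\<^sub>d E' 3),
        ((Inr 2, Inl 3), (- a12) \<bullet>\<^sub>d E 2),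
        ((Inr 2, Inr 1), (- a11 * l) \<bullet>\<^sub>d E' 3),
        ((Inr 1, Inl 3), (- a11) \<bullet>\<^sub>d E 2),
        ((Inl 3, Inr 2), (a11 * (1 - l)) \<bullet>\<^sub>d E 1 + (1 - l) \<bullet>\<^sub>d E' 1 + ((1 - l) * a12) \<bullet>\<^sub>d E 2)])) \<and>
     ((let r = a22 *s (e 2 \<otimes> e 2) + a23 *s (e 2 \<otimes> e 3 + e 3 \<otimes> e 2) + a33 *s (e 3 \<otimes> e 3)
      in symmetric_tensor r \<and> D_equation (H0_prec l) (H0_succ l) r) \<and>
     Connes_double_construction H0_mult (table_product
       [((Inl 1, Inl 3), E 2),
        ((Inr 2, Inr 2), ((l - 1) * a23) \<bullet>\<^sub>d E' 1),
        ((Inl 1, Inr 2), (- a23) \<bullet>\<^sub>d E 2),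
        ((Inl 3, Inr 2), (1 - l) \<bullet>\<^sub>d E' 1),
        ((Inr 3, Inr 2), ((l - 1) * a33) \<bullet>\<^sub>d E' 1),
        ((Inl 1, Inr 3), (- a33) \<bullet>\<^sub>d E 2),
        ((Inr 2, Inl 1), l \<bullet>\<^sub>d (a23 \<bullet>\<^sub>d E 2 + a33 \<bullet>\<^sub>d E 3 + E' 3))])) \<and>
     ((let r = a12 *s (e 1 \<otimes> e 2 + e 2 \<otimes> e 1) + a22 *s (e 2 \<otimes> e 2) + a23 *s (e 2 \<otimes> e 3 + e 3 \<otimes> e 2)
      in symmetric_tensor r \<and> D_equation (H0_prec l) (H0_succ l) r) \<and>
     Connes_double_construction H0_mult (table_product
       [((Inl 1, Inl 3), E 2),
        ((Inr 2, Inr 2), (a23 * (l - 1)) \<bullet>\<^sub>d E' 1),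
        ((Inr 2, Inl 3), (a12 * (l - 1)) \<bullet>\<^sub>d E 2),
        ((Inl 1, Inr 2), (- a23) \<bullet>\<^sub>d E 2),
        ((Inl 3, Inr 2), (1 - l) \<bullet>\<^sub>d (a12 \<bullet>\<^sub>d E 2 + E' 1)),
        ((Inr 2, Inl 1), l \<bullet>\<^sub>d (a23 \<bullet>\<^sub>d E 2 + E' 3))]))"
  by (intro conjI D_solution_span_e1_e2 D_solution_span_e2_e3 D_solution_mixed
      Connes_double_span_e1_e2 Connes_double_span_e2_e3 Connes_double_mixed)

end
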